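(* Let $\phi$ be an updating rule and $\mathcal{P}$ a class of true densities. Assume: (1) $\Theta\subseteq\mathbb{R}^k$ is open and convex, $\vartheta_{t|t-1}\in\Theta$ and $\vartheta_{t|t}(Y_t)=\phi(Y_t,\vartheta_{t|t-1})\in\Theta$ (almost surely); (2) $\log f(x|\vartheta)$ is twice continuously differentiable in $\vartheta$ for all $\vartheta\in\Theta$ and $x\in\mathcal{Y}$; (3) $\mathbb{E}_{p_t}[s(X_t,\vartheta_{t|t-1})]$ and $\mathbb{E}_{p_t}[\|\Delta\phi(Y_t,\vartheta_{t|t-1})\|^2]$ are finite for all $\vartheta_{t|t-1}\in\Theta$ and $p_t\in\mathcal{P}$; (4) there exists a constant $c<\infty$ such that $\sup_{\vartheta\in\Theta}\|\mathbb{E}_{p_t}[H(X_t,\vartheta)]\|\le c$ for all $p_t\in\mathcal{P}$. Then, for each $\vartheta_{t|t-1}\in\Theta$ and $p_t\in\mathcal{P}$ such that $\mathbb{E}_{p_t}[\Delta\phi(Y_t,\vartheta_{t|t-1})]^\top\,\mathbb{E}_{p_t}[s(X_t,\vartheta_{t|t-1})]\neq 0$, the following are equivalent: (a) $\mathbb{E}_{p_t}[\Delta\phi(Y_t,\vartheta_{t|t-1})]^\top\,\mathbb{E}_{p_t}[s(X_t,\vartheta_{t|t-1})]>0$; (b) there exists $\bar\kappa>0$ (with $\bar\kappa\le 1$) such that for all $\kappa\in(0,\bar\kappa]$: $\Delta^{\mathsf{EKL}}(\phi_\kappa|\vartheta_{t|t-1},p_t)<0$.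
   Context: Setting. Let $\mathcal{Y}\subseteq\mathbb{R}^l$ be the outcome space and fix a time $t$. Conditionally on the information set $\mathcal{F}_{t-1}$ at time $t-1$, the observation $Y_t$ has true density $p_t$ on $\mathcal{Y}$, belonging to a class $\mathcal{P}$ of absolutely continuous distributions (identified with their densities). Quantities known given $\mathcal{F}_{t-1}$, such as the predicted parameter $\vartheta_{t|t-1}\in\Theta$, are treated as fixed. $\mathbb{E}_{p_t}$ denotes expectation under $p_t$, and $X_t$ denotes an independent copy of $Y_t$. The postulated (possibly misspecified) model is a family of densities $f(\cdot|\vartheta)$, $\vartheta\in\Theta\subseteq\mathbb{R}^k$; the support of $p_t$ is assumed to be contained in the support of $f(\cdot|\vartheta)$ for all $\vartheta\in\Theta$. The score is $s(y,\vartheta)=\frac{\partial}{\partial\vartheta}\log f(y|\vartheta)$ and the Hessian is $H(x,\vartheta)=\frac{\partial^2}{\partial\vartheta\,\partial\vartheta^\top}\log f(x|\vartheta)$. $\|\cdot\|$ is the Euclidean norm for vectors and the spectral norm for matrices. Updating rules. An updating rule is a map $\phi:\mathcal{Y}\times\Theta\to\Theta$; the updated parameter is $\vartheta_{t|t}(y)=\phi(y,\vartheta_{t|t-1})$ and $\Delta\phi(y,\vartheta_{t|t-1}):=\vartheta_{t|t}(y)-\vartheta_{t|t-1}$. For $0<\kappa\le 1$, the linearly downscaled rule $\phi_\kappa$ is $\phi_\kappa(y,\vartheta_{t|t-1})=\vartheta_{t|t-1}+\kappa\,\Delta\phi(y,\vartheta_{t|t-1})$. EKL. For an updating rule $\phi$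 with $\vartheta_{t|t}(y)=\phi(y,\vartheta_{t|t-1})$, $$\mathsf{EKL}(p_t\Vert f_{t|t}):=\int_{\mathcal{Y}}\int_{\mathcal{Y}}\log\Big(\frac{p_t(x)}{f(x|\vartheta_{t|t}(y))}\Big)p_t(x)\,p_t(y)\,dx\,dy,$$ $$\mathsf{EKL}(p_t\Vert f_{t|t-1})=\int_{\mathcal{Y}}\log\Big(\frac{p_t(x)}{f(x|\vartheta_{t|t-1})}\Big)p_t(x)\,dx,$$ assumed finite throughout, and $\Delta^{\mathsf{EKL}}(\phi|\vartheta_{t|t-1},p_t):=\mathsf{EKL}(p_t\Vert f_{t|t})-\mathsf{EKL}(p_t\Vert f_{t|t-1})$.
   Formalization: Added assumption: for almost every y, the Hessian H(X, θ+uΔφ(y,θ)) is jointly integrable in (u, X) over u in [0,1], so that expectation and the Taylor remainder integral can be exchanged; with only the bound (4) on the expected Hessian the claim is false. *)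

theory Defs
  imports "HOL-Analysis.Analysis"
begin

section \<open>Differential calculus in the parameter\<close>

definition gradient :: "(real^'k \<Rightarrow> real) \<Rightarrow> real^'k \<Rightarrow> real^'k" where
  "gradient g \<theta> = (\<chi> i. frechet_derivative g (at \<theta>) (axis i 1))"

definition hessian :: "(real^'k \<Rightarrow> real) \<Rightarrow> real^'k \<Rightarrow> real^'k^'k" where
  "hessian g \<theta> = jacobian (gradient g) (at \<theta>)"

text \<open>The derivatives are taken at \<open>at \<theta>\<close>, so this is meant for open \<open>S\<close> only.\<close>

definition twice_continuously_differentiable_on ::
    "(real^'k \<Rightarrow> real) \<Rightarrow> (real^'k) set \<Rightarrow> bool" where
  "twice_continuously_differentiable_on g S \<longleftrightarrow>
     (\<forall>\<theta>\<in>S. g differentiable (at \<theta>)) \<and>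
     (\<forall>\<theta>\<in>S. gradient g differentiable (at \<theta>)) \<and>
     continuous_on S (hessian g)"

text \<open>The library's \<open>norm\<close> on matrices is the Frobenius norm, hence the operator norm here.\<close>

definition spectral_norm :: "real^'k^'k \<Rightarrow> real" where
  "spectral_norm A = onorm ((*v) A)"


section \<open>Densities on the outcome space\<close>

definition is_density :: "(real^'l) set \<Rightarrow> (real^'l \<Rightarrow> real) \<Rightarrow> bool" where
  "is_density Y p \<longleftrightarrow>
     p \<in> borel_measurable (lebesgue_on Y) \<and>
     (\<forall>x\<in>Y. 0 \<le> p x) \<and>
     (\<integral>\<^sup>+ x. ennreal (p x) \<partial>lebesgue_on Y) = 1"

text \<open>\<open>law Y p\<close> is the distribution with density \<open>p\<close>; the expectation of \<open>g\<close> under \<open>p\<close> is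
  \<open>LINT x|law Y p. g x\<close>, and it is finite iff \<open>integrable (law Y p) g\<close>.\<close>

definition law :: "(real^'l) set \<Rightarrow> (real^'l \<Rightarrow> real) \<Rightarrow> (real^'l) measure" where
  "law Y p = density (lebesgue_on Y) (\<lambda>x. ennreal (p x))"


section \<open>Score and Hessian of the postulated model\<close>

definition score ::
    "(real^'l \<Rightarrow> real^'k \<Rightarrow> real) \<Rightarrow> real^'l \<Rightarrow> real^'k \<Rightarrow> real^'k" where
  "score f y \<theta> = gradient (\<lambda>\<theta>'. ln (f y \<theta>')) \<theta>"

definition Hess ::
    "(real^'l \<Rightarrow> real^'k \<Rightarrow> real) \<Rightarrow> real^'l \<Rightarrow> real^'k \<Rightarrow> real^'k^'k" where
  "Hess f x \<theta> = hessian (\<lambda>\<theta>'. ln (f x \<theta>')) \<theta>"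


section \<open>Updating rules\<close>

definition upd_diff ::
    "(real^'l \<Rightarrow> real^'k \<Rightarrow> real^'k) \<Rightarrow> real^'l \<Rightarrow> real^'k \<Rightarrow> real^'k" where
  "upd_diff \<phi> y \<theta> = \<phi> y \<theta> - \<theta>"

definition downscale ::
    "real \<Rightarrow> (real^'l \<Rightarrow> real^'k \<Rightarrow> real^'k) \<Rightarrow> real^'l \<Rightarrow> real^'k \<Rightarrow> real^'k" where
  "downscale \<kappa> \<phi> y \<theta> = \<theta> + \<kappa> *\<^sub>R upd_diff \<phi> y \<theta>"


section \<open>Expected Kullback-Leibler divergence\<close>

text \<open>A point with \<open>p x = 0\<close> contributes nothing, since \<open>law Y p\<close> puts no mass on such points.\<close>

definition EKL_pred ::
    "(real^'l) set \<Rightarrow> (real^'l \<Rightarrow> real^'k \<Rightarrow> real) \<Rightarrow> (real^'l \<Rightarrow> real) \<Rightarrow> real^'k \<Rightarrow> real" where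
  "EKL_pred Y f p \<theta> = (LINT x|law Y p. ln (p x / f x \<theta>))"

definition EKL_upd ::
    "(real^'l) set \<Rightarrow> (real^'l \<Rightarrow> real^'k \<Rightarrow> real) \<Rightarrow> (real^'l \<Rightarrow> real) \<Rightarrow>
     (real^'l \<Rightarrow> real^'k \<Rightarrow> real^'k) \<Rightarrow> real^'k \<Rightarrow> real" where
  "EKL_upd Y f p \<phi> \<theta> = (LINT y|law Y p. (LINT x|law Y p. ln (p x / f x (\<phi> y \<theta>))))"

text \<open>Finiteness is stated separately because the Bochner integral of a non-integrable function
  is 0. In the second definition it is finiteness of the iterated integral; the inner integrals
  are Kullback-Leibler divergences and therefore nonnegative.\<close>

definition EKL_pred_finite ::
    "(real^'l) set \<Rightarrow> (real^'l \<Rightarrow> real^'k \<Rightarrow> real) \<Rightarrow> (real^'l \<Rightarrow> real) \<Rightarrow> real^'k \<Rightarrow> bool" where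
  "EKL_pred_finite Y f p \<theta> \<longleftrightarrow> integrable (law Y p) (\<lambda>x. ln (p x / f x \<theta>))"

definition EKL_upd_finite ::
    "(real^'l) set \<Rightarrow> (real^'l \<Rightarrow> real^'k \<Rightarrow> real) \<Rightarrow> (real^'l \<Rightarrow> real) \<Rightarrow>
     (real^'l \<Rightarrow> real^'k \<Rightarrow> real^'k) \<Rightarrow> real^'k \<Rightarrow> bool" where
  "EKL_upd_finite Y f p \<phi> \<theta> \<longleftrightarrow>
     (AE y in law Y p. integrable (law Y p) (\<lambda>x. ln (p x / f x (\<phi> y \<theta>)))) \<and>
     integrable (law Y p) (\<lambda>y. LINT x|law Y p. ln (p x / f x (\<phi> y \<theta>)))"

definition Delta_EKL ::
    "(real^'l) set \<Rightarrow> (real^'l \<Rightarrow> real^'k \<Rightarrow> real) \<Rightarrow> (real^'l \<Rightarrow> real^'k \<Rightarrow> real^'k) \<Rightarrow>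
     real^'k \<Rightarrow> (real^'l \<Rightarrow> real) \<Rightarrow> real" where
  "Delta_EKL Y f \<phi> \<theta> p = EKL_upd Y f p \<phi> \<theta> - EKL_pred Y f p \<theta>"


section \<open>Interchange of expectation and integration along update segments\<close>

text \<open>Fubini's condition for the Hessian along the segment from \<open>\<theta>\<close> to \<open>\<phi> y \<theta>\<close>: a second-order
  Taylor remainder of the expected log-likelihood is \<open>\<integral>\<^sub>0\<^sup>1 (1 - u) v\<^sup>T E[H(X, \<theta> + u v)] v du\<close>,
  with \<open>v = upd_diff \<phi> y \<theta>\<close>, only if the expectation and the integral over \<open>u\<close> can be
  exchanged. This does not follow from a bound on the norm of \<open>E[H(X, \<theta>)]\<close>, not even if
  \<open>H(X, \<theta>)\<close> is integrable for every \<open>\<theta>\<close>.\<close>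

definition Hess_segment_integrable ::
    "(real^'l) set \<Rightarrow> (real^'l \<Rightarrow> real^'k \<Rightarrow> real) \<Rightarrow> (real^'l \<Rightarrow> real) \<Rightarrow>
     (real^'l \<Rightarrow> real^'k \<Rightarrow> real^'k) \<Rightarrow> real^'k \<Rightarrow> bool" where
  "Hess_segment_integrable Y f p \<phi> \<theta> \<longleftrightarrow>
     (AE y in law Y p.
        integrable (lebesgue_on {0..1} \<Otimes>\<^sub>M law Y p)
          (\<lambda>(u, x). Hess f x (\<theta> + u *\<^sub>R upd_diff \<phi> y \<theta>)))"

end

theory Submission
  imports Defs
begin

text \<open>
  Write \<open>v y = upd_diff \<phi> y \<theta>\<close> and \<open>a = E[v(Y)] \<bullet> E[score(X, \<theta>)]\<close>. The density \<open>p\<close> cancels from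
  the difference of the two divergences, which is therefore minus the expected gain in
  log-likelihood,
  \<open>- E[ln f(X | \<theta> + \<kappa> v(Y)) - ln f(X | \<theta>)]\<close> for independent draws \<open>X\<close>, \<open>Y\<close> from \<open>p\<close>. To first order in \<open>\<kappa>\<close> the
  gain is \<open>\<kappa> v(Y) \<bullet> score(X, \<theta>)\<close>, whose expectation factorises by independence into \<open>\<kappa> a\<close>.
  The remainder is of order \<open>\<kappa>\<^sup>2\<close> uniformly, so that
  \<open>Delta_EKL = - \<kappa> a + O(\<kappa>\<^sup>2)\<close> (\<open>Delta_EKL_downscale_expansion\<close>), and for \<open>a \<noteq> 0\<close> the sign
  for all small \<open>\<kappa>\<close> is that of \<open>- a\<close> (\<open>eventually_negative_iff_slope\<close>).

  The delicate point is the remainder, because only the norm of the \<^emph>\<open>expected\<close> Hessian is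
  bounded: the Hessian of an individual log-likelihood may be arbitrarily large, so a pointwise
  mean-value estimate is useless. The remainder is instead kept in integral form
  (\<open>taylor_along_segment\<close>), and for fixed \<open>y\<close> the expectation over \<open>X\<close> is moved inside the
  integral over the segment by Fubini's theorem; there it meets the Hessian, and the
  bound applies (\<open>expected_taylor_bound\<close>). What is left is at most a constant times
  \<open>\<kappa>\<^sup>2 (norm (v y))\<^sup>2\<close>, which is integrable over \<open>y\<close>.
\<close>

section \<open>Second-order expansion along a segment\<close>

lemma linear_axis_sum:
  fixes L :: "real^'k \<Rightarrow> real"
  assumes "linear L"
  shows "L v = v \<bullet> (\<chi> i. L (axis i 1))"
proof -
  have "L v = L (\<Sum>i\<in>UNIV. (v $ i) *\<^sub>R axis i 1)"
    by (simp add: basis_expansion flip: scalar_mult_eq_scaleR)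
  also have "\<dots> = (\<Sum>i\<in>UNIV. (v $ i) * L (axis i 1))"
    by (simp add: linear_sum[OF assms] linear_cmul[OF assms])
  finally show ?thesis
    by (simp add: inner_vec_def)
qed

lemma has_derivative_gradient:
  assumes "g differentiable (at \<theta>)"
  shows "(g has_derivative (\<lambda>v. v \<bullet> gradient g \<theta>)) (at \<theta>)"
proof -
  have d: "(g has_derivative frechet_derivative g (at \<theta>)) (at \<theta>)"
    using assms by (simp add: frechet_derivative_works)
  have "frechet_derivative g (at \<theta>) = (\<lambda>v. v \<bullet> gradient g \<theta>)"
    unfolding gradient_def by (rule ext) (rule linear_axis_sum[OF has_derivative_linear[OF d]])
  with d show ?thesis by simp
qed

lemma has_derivative_hessian:
  assumes "gradient g differentiable (at \<theta>)"
  shows "(gradient g has_derivative (*v) (hessian g \<theta>)) (at \<theta>)"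
  using assms unfolding hessian_def jacobian_works .

text \<open>Truncating the weight \<open>\<kappa> - u\<close> of the integral remainder extends the range of integration
  from \<open>{0..\<kappa>}\<close> to the whole segment between \<open>\<theta>\<close> and \<open>\<theta> + v\<close>, the one on which the Hessian is assumed to be jointly integrable below; the weight is
  continuous, so the integrand stays continuous there.\<close>

lemma taylor_along_segment:
  fixes g :: "real^'k \<Rightarrow> real"
  assumes C2: "twice_continuously_differentiable_on g \<Theta>"
    and cvx: "convex \<Theta>" and \<theta>: "\<theta> \<in> \<Theta>" and \<theta>v: "\<theta> + v \<in> \<Theta>"
    and \<kappa>: "0 \<le> \<kappa>" "\<kappa> \<le> 1"
  shows "g (\<theta> + \<kappa> *\<^sub>R v) - g \<theta> - \<kappa> * (v \<bullet> gradient g \<theta>) =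
    (LINT u|lebesgue_on {0..1}. max 0 (\<kappa> - u) * (v \<bullet> (hessian g (\<theta> + u *\<^sub>R v) *v v)))"
proof -
  define q where "q = (\<lambda>u. v \<bullet> (hessian g (\<theta> + u *\<^sub>R v) *v v))"
  have seg: "\<theta> + u *\<^sub>R v \<in> \<Theta>" if "u \<in> {0..1}" for u
    using convexD_alt[OF cvx \<theta> \<theta>v, of u] that by (simp add: algebra_simps)
  have cont_q: "continuous_on {0..1} q"
  proof -
    have "continuous_on {0..1} (\<lambda>u. hessian g (\<theta> + u *\<^sub>R v))"
    proof (rule continuous_on_compose2[of \<Theta> "hessian g"])
      show "continuous_on \<Theta> (hessian g)"
        using C2 by (simp add: twice_continuously_differentiable_on_def)
    qed (use seg in \<open>auto intro!: continuous_intros\<close>)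
    then show ?thesis
      unfolding q_def matrix_vector_mult_def inner_vec_def
      by (intro continuous_intros) (auto intro!: continuous_intros)
  qed
  \<comment> \<open>An explicit antiderivative of the remainder: in \<open>G'\<close> the two gradient terms cancel.\<close>
  define G where "G = (\<lambda>u. (\<kappa> - u) * (v \<bullet> gradient g (\<theta> + u *\<^sub>R v)) + g (\<theta> + u *\<^sub>R v))"
  have G': "(G has_vector_derivative (\<kappa> - u) * q u) (at u within {0..\<kappa>})" if u: "u \<in> {0..\<kappa>}" for u
  proof -
    have "\<theta> + u *\<^sub>R v \<in> \<Theta>" using seg u \<kappa> by auto
    then have dg: "(g has_derivative (\<lambda>w. w \<bullet> gradient g (\<theta> + u *\<^sub>R v))) (at (\<theta> + u *\<^sub>R v))"
      and dgr: "(gradient g has_derivative (*v) (hessian g (\<theta> + u *\<^sub>R v))) (at (\<theta> + u *\<^sub>R v))"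
      using C2 by (auto simp: twice_continuously_differentiable_on_def
          intro: has_derivative_gradient has_derivative_hessian)
    have line: "((\<lambda>u. \<theta> + u *\<^sub>R v) has_derivative (\<lambda>h. h *\<^sub>R v)) (at u)"
      by (auto intro!: derivative_eq_intros)
    have 1: "((\<lambda>u. g (\<theta> + u *\<^sub>R v)) has_derivative (\<lambda>h. (h *\<^sub>R v) \<bullet> gradient g (\<theta> + u *\<^sub>R v))) (at u)"
      using has_derivative_compose[OF line dg] .
    have 2: "((\<lambda>u. gradient g (\<theta> + u *\<^sub>R v)) has_derivative
        (\<lambda>h. hessian g (\<theta> + u *\<^sub>R v) *v (h *\<^sub>R v))) (at u)"
      using has_derivative_compose[OF line dgr] .
    have "(G has_derivative (\<lambda>h. h *\<^sub>R ((\<kappa> - u) * q u))) (at u)"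
      unfolding G_def
      by (rule derivative_eq_intros 1 2 refl)+
         (auto simp: q_def matrix_vector_mult_scaleR algebra_simps)
    then show ?thesis
      unfolding has_vector_derivative_def by (rule has_derivative_at_withinI)
  qed
  have "((\<lambda>u. (\<kappa> - u) * q u) has_integral (G \<kappa> - G 0)) {0..\<kappa>}"
    by (rule fundamental_theorem_of_calculus[OF \<kappa>(1) G'])
  then have "((\<lambda>u. if u \<in> {0..\<kappa>} then (\<kappa> - u) * q u else 0) has_integral (G \<kappa> - G 0)) {0..1}"
    using \<kappa> by (subst has_integral_restrict) auto
  then have "((\<lambda>u. max 0 (\<kappa> - u) * q u) has_integral (G \<kappa> - G 0)) {0..1}"
    by (rule has_integral_eq[rotated]) auto
  moreover have "continuous_on {0..1} (\<lambda>u. max 0 (\<kappa> - u) * q u)"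
    by (intro continuous_intros cont_q)
  ultimately have "(LINT u|lebesgue_on {0..1}. max 0 (\<kappa> - u) * q u) = G \<kappa> - G 0"
    by (simp add: lebesgue_integral_eq_integral continuous_imp_integrable_real integral_unique)
  then show ?thesis
    by (simp add: G_def q_def)
qed

lemma abs_quadratic_form_le_spectral_norm:
  "\<bar>v \<bullet> (A *v v)\<bar> \<le> spectral_norm A * (norm v)\<^sup>2"
proof -
  have "\<bar>v \<bullet> (A *v v)\<bar> \<le> norm v * norm (A *v v)"
    by (rule Cauchy_Schwarz_ineq2)
  also have "\<dots> \<le> norm v * (spectral_norm A * norm v)"
    unfolding spectral_norm_def
    by (intro mult_left_mono onorm matrix_vector_mul_bounded_linear) simp
  finally show ?thesis by (simp add: power2_eq_square mult_ac)
qed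

lemma bounded_linear_quadratic_form:
  "bounded_linear (\<lambda>A :: real^'k^'k. v \<bullet> (A *v v))"
  unfolding linear_conv_bounded_linear[symmetric]
  by (rule linearI) (simp_all add: matrix_vector_mult_add_rdistrib inner_add_right
      scaleR_matrix_vector_assoc[symmetric])

section \<open>Expected log-likelihood along an update\<close>

text \<open>Taking the expectation inside the remainder integral is what makes a bound on the expected
  Hessian sufficient. The weight is at most \<open>\<kappa>\<close> and vanishes outside \<open>{0..\<kappa>}\<close>, which gives the
  factor \<open>\<kappa>\<^sup>2\<close>; the sharp constant would be \<open>c / 2\<close>, but only the order in \<open>\<kappa>\<close> matters below.\<close>

lemma expected_taylor_bound:
  fixes l :: "'a \<Rightarrow> real^'k \<Rightarrow> real"
  assumes M: "sigma_finite_measure M"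
    and C2: "\<And>x. x \<in> space M \<Longrightarrow> twice_continuously_differentiable_on (l x) \<Theta>"
    and cvx: "convex \<Theta>" and \<theta>: "\<theta> \<in> \<Theta>" and \<theta>v: "\<theta> + v \<in> \<Theta>"
    and \<kappa>: "0 \<le> \<kappa>" "\<kappa> \<le> 1"
    and int_l: "integrable M (\<lambda>x. l x (\<theta> + \<kappa> *\<^sub>R v) - l x \<theta>)"
    and int_grad: "integrable M (\<lambda>x. gradient (l x) \<theta>)"
    and int_hess: "\<And>\<theta>'. \<theta>' \<in> \<Theta> \<Longrightarrow> integrable M (\<lambda>x. hessian (l x) \<theta>')"
    and bound: "\<And>\<theta>'. \<theta>' \<in> \<Theta> \<Longrightarrow> spectral_norm (LINT x|M. hessian (l x) \<theta>') \<le> c"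
    and segment: "integrable (lebesgue_on {0..1} \<Otimes>\<^sub>M M) (\<lambda>(u, x). hessian (l x) (\<theta> + u *\<^sub>R v))"
  shows "\<bar>(LINT x|M. l x (\<theta> + \<kappa> *\<^sub>R v) - l x \<theta>) - \<kappa> * (v \<bullet> (LINT x|M. gradient (l x) \<theta>))\<bar>
    \<le> c * \<kappa>\<^sup>2 * (norm v)\<^sup>2"
proof -
  let ?I = "lebesgue_on {0..1::real}"
  interpret M: sigma_finite_measure M by fact
  interpret I: sigma_finite_measure ?I
    by (rule finite_measure.axioms(1)) (auto intro!: finite_measureI simp: emeasure_restrict_space)
  interpret pair_sigma_finite ?I M ..
  define q where "q = (\<lambda>u x. v \<bullet> (hessian (l x) (\<theta> + u *\<^sub>R v) *v v))"
  have seg: "\<theta> + u *\<^sub>R v \<in> \<Theta>" if "u \<in> {0..1}" for u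
    using convexD_alt[OF cvx \<theta> \<theta>v, of u] that by (simp add: algebra_simps)
  have w_meas: "(\<lambda>u. max 0 (\<kappa> - u)) \<in> borel_measurable ?I"
    by (intro borel_measurable_integrable continuous_imp_integrable_real continuous_intros)
  have int_q: "integrable (?I \<Otimes>\<^sub>M M) (\<lambda>(u, x). q u x)"
    using integrable_bounded_linear[OF bounded_linear_quadratic_form segment, of v]
    by (simp add: q_def case_prod_unfold)
  have int_wq: "integrable (?I \<Otimes>\<^sub>M M) (\<lambda>(u, x). max 0 (\<kappa> - u) * q u x)"
  proof (rule Bochner_Integration.integrable_bound[OF int_q])
    show "(\<lambda>(u, x). max 0 (\<kappa> - u) * q u x) \<in> borel_measurable (?I \<Otimes>\<^sub>M M)"
      using borel_measurable_times[OF measurable_compose[OF measurable_fst w_meas]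
          borel_measurable_integrable[OF int_q]]
      by (simp add: case_prod_unfold)
    show "AE z in ?I \<Otimes>\<^sub>M M. norm (case z of (u, x) \<Rightarrow> max 0 (\<kappa> - u) * q u x)
        \<le> norm (case z of (u, x) \<Rightarrow> q u x)"
      using \<kappa> by (intro AE_I2)
        (auto simp: space_pair_measure abs_mult intro!: mult_left_le_one_le)
  qed
  have "(LINT x|M. l x (\<theta> + \<kappa> *\<^sub>R v) - l x \<theta>) - \<kappa> * (v \<bullet> (LINT x|M. gradient (l x) \<theta>))
      = (LINT x|M. l x (\<theta> + \<kappa> *\<^sub>R v) - l x \<theta> - \<kappa> * (v \<bullet> gradient (l x) \<theta>))"
    using int_l int_grad by (subst Bochner_Integration.integral_diff) auto
  also have "\<dots> = (LINT x|M. LINT u|?I. max 0 (\<kappa> - u) * q u x)"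
    unfolding q_def
    by (intro Bochner_Integration.integral_cong refl taylor_along_segment[OF C2 cvx \<theta> \<theta>v \<kappa>])
  also have "\<dots> = (LINT u|?I. LINT x|M. max 0 (\<kappa> - u) * q u x)"
    by (rule Fubini_integral[OF int_wq])
  also have "\<bar>\<dots>\<bar> \<le> (LINT u|?I. indicator {0..\<kappa>} u * (\<kappa> * (c * (norm v)\<^sup>2)))"
  proof (rule integral_abs_bound_integral)
    show "integrable ?I (\<lambda>u. LINT x|M. max 0 (\<kappa> - u) * q u x)"
      using integrable_fst'[OF int_wq] by simp
    show "integrable ?I (\<lambda>u. indicator {0..\<kappa>} u * (\<kappa> * (c * (norm v)\<^sup>2)))"
      using \<kappa> by (intro integrable_mult_left integrable_real_indicator)
        (auto simp: sets_restrict_space_iff emeasure_restrict_space)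
    fix u assume "u \<in> space ?I"
    then have u: "u \<in> {0..1}" by simp
    have "(LINT x|M. q u x) = v \<bullet> ((LINT x|M. hessian (l x) (\<theta> + u *\<^sub>R v)) *v v)"
      unfolding q_def
      by (rule integral_bounded_linear[OF bounded_linear_quadratic_form int_hess[OF seg[OF u]]])
    also have "\<bar>\<dots>\<bar> \<le> c * (norm v)\<^sup>2"
      using abs_quadratic_form_le_spectral_norm mult_right_mono[OF bound[OF seg[OF u]]]
      by (rule order_trans) simp
    finally have *: "\<bar>LINT x|M. q u x\<bar> \<le> c * (norm v)\<^sup>2" .
    have "\<bar>LINT x|M. max 0 (\<kappa> - u) * q u x\<bar> = max 0 (\<kappa> - u) * \<bar>LINT x|M. q u x\<bar>"
      by (simp add: abs_mult)
    also have "\<dots> \<le> (indicator {0..\<kappa>} u * \<kappa>) * (c * (norm v)\<^sup>2)"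
      using u by (intro mult_mono *) (auto simp: indicator_def)
    finally show "\<bar>LINT x|M. max 0 (\<kappa> - u) * q u x\<bar> \<le> indicator {0..\<kappa>} u * (\<kappa> * (c * (norm v)\<^sup>2))"
      by (simp add: mult_ac)
  qed
  also have "(LINT u|?I. indicator {0..\<kappa>} u * (\<kappa> * (c * (norm v)\<^sup>2)))
      = measure ?I {0..\<kappa>} * (\<kappa> * (c * (norm v)\<^sup>2))"
    using \<kappa> by (simp add: Int_absorb2)
  also have "measure ?I {0..\<kappa>} = \<kappa>"
    using \<kappa> by (simp add: measure_restrict_space)
  finally show ?thesis by (simp add: power2_eq_square mult_ac)
qed

section \<open>The law of the observation\<close>

lemma space_law: "space (law Y p) = Y"
  by (simp add: law_def)

lemma measurable_law: "measurable (law Y p) N = measurable (lebesgue_on Y) N"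
  by (rule measurable_cong_sets) (simp_all add: law_def)

lemma emeasure_space_law:
  assumes "is_density Y p"
  shows "emeasure (law Y p) Y = 1"
proof -
  have meas: "(\<lambda>x. ennreal (p x)) \<in> borel_measurable (lebesgue_on Y)"
    using assms by (auto simp: is_density_def)
  have "Y \<in> sets (lebesgue_on Y)"
    using sets.top[of "lebesgue_on Y"] by simp
  then have "emeasure (law Y p) Y = (\<integral>\<^sup>+ x. ennreal (p x) * indicator Y x \<partial>lebesgue_on Y)"
    unfolding law_def by (rule emeasure_density[OF meas])
  also have "\<dots> = (\<integral>\<^sup>+ x. ennreal (p x) \<partial>lebesgue_on Y)"
    by (intro nn_integral_cong) simp
  finally show ?thesis using assms by (simp add: is_density_def)
qed

lemma finite_measure_law:
  assumes "is_density Y p"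
  shows "finite_measure (law Y p)"
  by (rule finite_measureI) (simp add: space_law emeasure_space_law[OF assms])

lemma integral_const_law:
  assumes "is_density Y p"
  shows "(LINT y|law Y p. (b::real)) = b"
  by (simp add: measure_def space_law emeasure_space_law[OF assms])

lemma AE_law_density_pos:
  assumes "is_density Y p"
  shows "AE x in law Y p. 0 < p x"
proof -
  have "(\<lambda>x. ennreal (p x)) \<in> borel_measurable (lebesgue_on Y)"
    using assms by (auto simp: is_density_def)
  then show ?thesis
    unfolding law_def by (simp add: AE_density)
qed

section \<open>Divergence reduction of a downscaled rule\<close>

text \<open>The true density cancels in \<open>ln (p x / f x \<theta>1) - ln (p x / f x \<theta>2)\<close> wherever it is positive,
  which is almost everywhere under its own law. Finiteness of both divergences thus yields
  integrability of the log-likelihood ratio, even if neither log-likelihood is integrable.\<close>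

lemma KL_difference:
  assumes p: "is_density Y p"
    and f1: "is_density Y (\<lambda>x. f x \<theta>1)" and f2: "is_density Y (\<lambda>x. f x \<theta>2)"
    and pos: "\<And>x. x \<in> Y \<Longrightarrow> 0 < f x \<theta>1" "\<And>x. x \<in> Y \<Longrightarrow> 0 < f x \<theta>2"
    and fin: "EKL_pred_finite Y f p \<theta>1" "EKL_pred_finite Y f p \<theta>2"
  shows "integrable (law Y p) (\<lambda>x. ln (f x \<theta>2) - ln (f x \<theta>1))"
    and "EKL_pred Y f p \<theta>2 - EKL_pred Y f p \<theta>1 = - (LINT x|law Y p. ln (f x \<theta>2) - ln (f x \<theta>1))"
proof -
  let ?K = "\<lambda>x. ln (p x / f x \<theta>1) - ln (p x / f x \<theta>2)"
  let ?l = "\<lambda>x. ln (f x \<theta>2) - ln (f x \<theta>1)"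
  have int: "integrable (law Y p) ?K"
    using fin by (auto simp: EKL_pred_finite_def)
  have ae: "AE x in law Y p. ?K x = ?l x"
    using AE_law_density_pos[OF p] AE_space[of "law Y p"]
    proof eventually_elim
    case (elim x)
    with pos[of x] show ?case
      by (simp add: space_law ln_divide_pos)
  qed
  have meas: "?l \<in> borel_measurable (law Y p)"
    using f1 f2 unfolding measurable_law is_density_def
    by (intro borel_measurable_diff borel_measurable_ln) auto
  show "integrable (law Y p) ?l"
    using integrable_cong_AE_imp[OF int meas] ae by (simp add: eq_commute)
  have "(LINT x|law Y p. ?l x) = (LINT x|law Y p. ?K x)"
    using ae by (intro integral_cong_AE meas borel_measurable_integrable[OF int]) (auto simp: eq_commute)
  then show "EKL_pred Y f p \<theta>2 - EKL_pred Y f p \<theta>1 = - (LINT x|law Y p. ?l x)"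
    using fin by (simp add: EKL_pred_def EKL_pred_finite_def)
qed

text \<open>For fixed \<open>y\<close> the inner integral of \<open>EKL_upd\<close> is the divergence at the parameter
  \<open>\<theta> + \<kappa> v y\<close>, so \<open>KL_difference\<close> and \<open>expected_taylor_bound\<close> expand it around \<open>\<theta>\<close>. Integrating
  over \<open>y\<close> turns the linear term into the inner product of the two means and the remainder into
  a multiple of the second moment of the update.\<close>

lemma Delta_EKL_downscale_expansion:
  fixes f :: "real^'l \<Rightarrow> real^'k \<Rightarrow> real"
  assumes p: "is_density Y p" and \<theta>: "\<theta> \<in> \<Theta>" and cvx: "convex \<Theta>"
    and f_density: "\<And>\<theta>'. \<theta>' \<in> \<Theta> \<Longrightarrow> is_density Y (\<lambda>x. f x \<theta>')"
    and f_pos: "\<And>x \<theta>'. x \<in> Y \<Longrightarrow> \<theta>' \<in> \<Theta> \<Longrightarrow> 0 < f x \<theta>'"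
    and C2: "\<And>x. x \<in> Y \<Longrightarrow> twice_continuously_differentiable_on (\<lambda>\<theta>. ln (f x \<theta>)) \<Theta>"
    and EKL_pred_fin: "\<And>\<theta>'. \<theta>' \<in> \<Theta> \<Longrightarrow> EKL_pred_finite Y f p \<theta>'"
    and EKL_upd_fin: "EKL_upd_finite Y f p (downscale \<kappa> \<phi>) \<theta>"
    and \<phi>_meas: "(\<lambda>y. \<phi> y \<theta>) \<in> borel_measurable (lebesgue_on Y)"
    and \<phi>_in: "AE y in law Y p. \<phi> y \<theta> \<in> \<Theta>"
    and score_fin: "integrable (law Y p) (\<lambda>x. score f x \<theta>)"
    and upd_fin: "integrable (law Y p) (\<lambda>y. (norm (upd_diff \<phi> y \<theta>))\<^sup>2)"
    and Hess_fin: "\<And>\<theta>'. \<theta>' \<in> \<Theta> \<Longrightarrow> integrable (law Y p) (\<lambda>x. Hess f x \<theta>')"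
    and Hess_le: "\<And>\<theta>'. \<theta>' \<in> \<Theta> \<Longrightarrow> spectral_norm (LINT x|law Y p. Hess f x \<theta>') \<le> c"
    and segment: "Hess_segment_integrable Y f p \<phi> \<theta>"
    and \<kappa>: "0 < \<kappa>" "\<kappa> \<le> 1"
  shows "\<bar>Delta_EKL Y f (downscale \<kappa> \<phi>) \<theta> p
      + \<kappa> * ((LINT y|law Y p. upd_diff \<phi> y \<theta>) \<bullet> (LINT x|law Y p. score f x \<theta>))\<bar>
    \<le> (c * (LINT y|law Y p. (norm (upd_diff \<phi> y \<theta>))\<^sup>2)) * \<kappa>\<^sup>2"
proof -
  interpret finite_measure "law Y p" by (rule finite_measure_law[OF p])
  define v where "v = (\<lambda>y. upd_diff \<phi> y \<theta>)"
  define S where "S = (LINT x|law Y p. score f x \<theta>)"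
  define K where "K = (\<lambda>y. EKL_pred Y f p (downscale \<kappa> \<phi> y \<theta>))"
  have v_meas: "v \<in> borel_measurable (law Y p)"
    using \<phi>_meas unfolding v_def upd_diff_def measurable_law by measurable
  have int_v2: "integrable (law Y p) (\<lambda>y. (norm (v y))\<^sup>2)"
    using upd_fin by (simp add: v_def)
  have int_v: "integrable (law Y p) v"
  proof (rule Bochner_Integration.integrable_bound[OF _ v_meas])
    show "integrable (law Y p) (\<lambda>y. 1 + (norm (v y))\<^sup>2)"
      using int_v2 by simp
    have "t \<le> 1 + t\<^sup>2" for t :: real
      \<comment> \<open>\<open>1 + t\<^sup>2 - t = (t - 1/2)\<^sup>2 + 3/4\<close>\<close>
      using zero_le_power2[of "t - 1/2"] by (simp add: power2_eq_square algebra_simps)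
    then show "AE y in law Y p. norm (v y) \<le> norm (1 + (norm (v y))\<^sup>2)"
      by simp
  qed
  have int_K: "integrable (law Y p) K"
    using EKL_upd_fin by (simp add: EKL_upd_finite_def K_def EKL_pred_def)
  have "Delta_EKL Y f (downscale \<kappa> \<phi>) \<theta> p + \<kappa> * ((LINT y|law Y p. v y) \<bullet> S)
      = (LINT y|law Y p. K y - EKL_pred Y f p \<theta> + \<kappa> * (v y \<bullet> S))"
    using int_K int_v integral_const_law[OF p]
    by (simp add: Delta_EKL_def EKL_upd_def K_def EKL_pred_def del: lebesgue_integral_const)
  also have "\<bar>\<dots>\<bar> \<le> (LINT y|law Y p. \<bar>K y - EKL_pred Y f p \<theta> + \<kappa> * (v y \<bullet> S)\<bar>)"
    by (rule integral_abs_bound)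
  also have "\<dots> \<le> (LINT y|law Y p. c * \<kappa>\<^sup>2 * (norm (v y))\<^sup>2)"
  proof (rule integral_mono_AE)
    show "integrable (law Y p) (\<lambda>y. \<bar>K y - EKL_pred Y f p \<theta> + \<kappa> * (v y \<bullet> S)\<bar>)"
      using int_K int_v by simp
    show "integrable (law Y p) (\<lambda>y. c * \<kappa>\<^sup>2 * (norm (v y))\<^sup>2)"
      using int_v2 by simp
    from \<phi>_in segment[unfolded Hess_segment_integrable_def]
    show "AE y in law Y p. \<bar>K y - EKL_pred Y f p \<theta> + \<kappa> * (v y \<bullet> S)\<bar> \<le> c * \<kappa>\<^sup>2 * (norm (v y))\<^sup>2"
    proof eventually_elim
      case (elim y)
      have \<theta>v: "\<theta> + v y \<in> \<Theta>"
        using elim(1) by (simp add: v_def upd_diff_def)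
      have \<theta>\<kappa>: "\<theta> + \<kappa> *\<^sub>R v y \<in> \<Theta>"
        using convexD_alt[OF cvx \<theta> \<theta>v, of \<kappa>] \<kappa> by (simp add: algebra_simps)
      note KL = KL_difference[where f = f, OF p f_density[OF \<theta>] f_density[OF \<theta>\<kappa>] f_pos[OF _ \<theta>] f_pos[OF _ \<theta>\<kappa>]
          EKL_pred_fin[OF \<theta>] EKL_pred_fin[OF \<theta>\<kappa>]]
      have "\<bar>(LINT x|law Y p. ln (f x (\<theta> + \<kappa> *\<^sub>R v y)) - ln (f x \<theta>)) - \<kappa> * (v y \<bullet> S)\<bar>
          \<le> c * \<kappa>\<^sup>2 * (norm (v y))\<^sup>2"
        unfolding S_def score_def
      proof (rule expected_taylor_bound[where l = "\<lambda>x \<theta>. ln (f x \<theta>)", OF _ _ cvx \<theta> \<theta>v _ _ KL(1)])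
        show "sigma_finite_measure (law Y p)" ..
      qed (use \<kappa> C2 score_fin Hess_fin Hess_le elim(2)
          in \<open>auto simp: space_law score_def Hess_def v_def\<close>)
      with KL(2) show ?case
        by (simp add: K_def downscale_def v_def)
    qed
  qed
  finally show ?thesis by (simp add: v_def S_def mult_ac)
qed

lemma eventually_negative_iff_slope:
  fixes D :: "real \<Rightarrow> real"
  assumes expansion: "\<And>\<kappa>. 0 < \<kappa> \<Longrightarrow> \<kappa> \<le> 1 \<Longrightarrow> \<bar>D \<kappa> + \<kappa> * a\<bar> \<le> C * \<kappa>\<^sup>2"
    and "a \<noteq> 0"
  shows "a > 0 \<longleftrightarrow> (\<exists>\<kappa>'>0. \<kappa>' \<le> 1 \<and> (\<forall>\<kappa>. 0 < \<kappa> \<and> \<kappa> \<le> \<kappa>' \<longrightarrow> D \<kappa> < 0))"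
proof -
  \<comment> \<open>Below this threshold the quadratic error is at most half the linear term; the summand 1 keeps
    the denominator positive when \<open>C = 0\<close>.\<close>
  define \<kappa>0 where "\<kappa>0 = min 1 (\<bar>a\<bar> / (2 * (\<bar>C\<bar> + 1)))"
  have \<kappa>0: "0 < \<kappa>0" "\<kappa>0 \<le> 1"
    using \<open>a \<noteq> 0\<close> by (auto simp: \<kappa>0_def)
  have dominated: "\<bar>D \<kappa> + \<kappa> * a\<bar> < \<kappa> * \<bar>a\<bar>" if \<kappa>: "0 < \<kappa>" "\<kappa> \<le> \<kappa>0" for \<kappa>
  proof -
    have "C * \<kappa> \<le> (\<bar>C\<bar> + 1) * \<kappa>"
      using \<kappa> by (intro mult_right_mono) auto
    also have "\<dots> \<le> (\<bar>C\<bar> + 1) * (\<bar>a\<bar> / (2 * (\<bar>C\<bar> + 1)))"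
      using \<kappa> by (intro mult_left_mono) (auto simp: \<kappa>0_def)
    also have "\<dots> = \<bar>a\<bar> / 2"
      by (simp add: field_simps)
    also have "\<dots> < \<bar>a\<bar>" using \<open>a \<noteq> 0\<close> by simp
    finally have "C * \<kappa>\<^sup>2 < \<kappa> * \<bar>a\<bar>"
      using \<kappa> mult_strict_left_mono[of "C * \<kappa>" "\<bar>a\<bar>" \<kappa>]
      by (simp add: power2_eq_square mult_ac)
    then show ?thesis
      using expansion[of \<kappa>] \<kappa> \<kappa>0 by linarith
  qed
  show ?thesis
  proof
    assume "a > 0"
    then have "D \<kappa> < 0" if "0 < \<kappa>" "\<kappa> \<le> \<kappa>0" for \<kappa>
      using dominated[OF that] by simp
    then show "\<exists>\<kappa>'>0. \<kappa>' \<le> 1 \<and> (\<forall>\<kappa>. 0 < \<kappa> \<and> \<kappa> \<le> \<kappa>' \<longrightarrow> D \<kappa> < 0)"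
      using \<kappa>0 by blast
  next
    assume "\<exists>\<kappa>'>0. \<kappa>' \<le> 1 \<and> (\<forall>\<kappa>. 0 < \<kappa> \<and> \<kappa> \<le> \<kappa>' \<longrightarrow> D \<kappa> < 0)"
    \<comment> \<open>With \<open>a < 0\<close> the function would be positive near 0, so its negativity at a single small point
      already forces \<open>a > 0\<close>.\<close>
    then obtain \<kappa>' where "0 < \<kappa>'" and neg: "\<And>\<kappa>. 0 < \<kappa> \<Longrightarrow> \<kappa> \<le> \<kappa>' \<Longrightarrow> D \<kappa> < 0"
      by blast
    define m where "m = min \<kappa>0 \<kappa>'"
    have m: "0 < m" "m \<le> \<kappa>0" "m \<le> \<kappa>'"
      using \<kappa>0 \<open>0 < \<kappa>'\<close> by (auto simp: m_def)
    have "\<not> a < 0"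
    proof
      assume "a < 0"
      then have "D m > 0" using dominated[OF m(1,2)] by simp
      with neg[OF m(1,3)] show False by simp
    qed
    with \<open>a \<noteq> 0\<close> show "a > 0" by simp
  qed
qed

theorem theorem1:
  fixes Y :: "(real^'l) set"
    and \<Theta> :: "(real^'k) set"
    and f :: "real^'l \<Rightarrow> real^'k \<Rightarrow> real"
    and \<phi> :: "real^'l \<Rightarrow> real^'k \<Rightarrow> real^'k"
    and P :: "(real^'l \<Rightarrow> real) set"
  assumes Y_meas: "Y \<in> sets lebesgue"
    and f_density: "\<And>\<theta>. \<theta> \<in> \<Theta> \<Longrightarrow> is_density Y (\<lambda>x. f x \<theta>)"
    and P_density: "\<And>p. p \<in> P \<Longrightarrow> is_density Y p"
    and support: "\<And>p \<theta>. p \<in> P \<Longrightarrow> \<theta> \<in> \<Theta> \<Longrightarrow> {x \<in> Y. 0 < p x} \<subseteq> {x \<in> Y. 0 < f x \<theta>}"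
    and \<phi>_meas: "\<And>\<theta>. \<theta> \<in> \<Theta> \<Longrightarrow> (\<lambda>y. \<phi> y \<theta>) \<in> borel_measurable (lebesgue_on Y)"
    and EKL_pred_fin: "\<And>p \<theta>. p \<in> P \<Longrightarrow> \<theta> \<in> \<Theta> \<Longrightarrow> EKL_pred_finite Y f p \<theta>"
    and EKL_upd_fin: "\<And>p \<theta> \<kappa>. p \<in> P \<Longrightarrow> \<theta> \<in> \<Theta> \<Longrightarrow> 0 < \<kappa> \<Longrightarrow> \<kappa> \<le> 1 \<Longrightarrow>
        EKL_upd_finite Y f p (downscale \<kappa> \<phi>) \<theta>"
    and \<Theta>_open: "open \<Theta>"
    and \<Theta>_convex: "convex \<Theta>"
    and \<phi>_in_\<Theta>: "\<And>p \<theta>. p \<in> P \<Longrightarrow> \<theta> \<in> \<Theta> \<Longrightarrow> AE y in law Y p. \<phi> y \<theta> \<in> \<Theta>"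
    and f_pos: "\<And>x \<theta>. x \<in> Y \<Longrightarrow> \<theta> \<in> \<Theta> \<Longrightarrow> 0 < f x \<theta>"
    and log_f_C2: "\<And>x. x \<in> Y \<Longrightarrow> twice_continuously_differentiable_on (\<lambda>\<theta>. ln (f x \<theta>)) \<Theta>"
    and score_fin: "\<And>p \<theta>. p \<in> P \<Longrightarrow> \<theta> \<in> \<Theta> \<Longrightarrow> integrable (law Y p) (\<lambda>x. score f x \<theta>)"
    and upd_fin: "\<And>p \<theta>. p \<in> P \<Longrightarrow> \<theta> \<in> \<Theta> \<Longrightarrow>
        integrable (law Y p) (\<lambda>y. (norm (upd_diff \<phi> y \<theta>))\<^sup>2)"
    and Hess_bound: "\<exists>c::real. \<forall>p\<in>P. \<forall>\<theta>\<in>\<Theta>.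
        integrable (law Y p) (\<lambda>x. Hess f x \<theta>) \<and>
        spectral_norm (LINT x|law Y p. Hess f x \<theta>) \<le> c"
    and Hess_segment: "\<And>p \<theta>. p \<in> P \<Longrightarrow> \<theta> \<in> \<Theta> \<Longrightarrow> Hess_segment_integrable Y f p \<phi> \<theta>"
  shows "\<forall>\<theta>\<in>\<Theta>. \<forall>p\<in>P.
      (LINT y|law Y p. upd_diff \<phi> y \<theta>) \<bullet> (LINT x|law Y p. score f x \<theta>) \<noteq> 0 \<longrightarrow>
      ((LINT y|law Y p. upd_diff \<phi> y \<theta>) \<bullet> (LINT x|law Y p. score f x \<theta>) > 0 \<longleftrightarrow>
       (\<exists>\<kappa>'>0. \<kappa>' \<le> 1 \<and>
          (\<forall>\<kappa>. 0 < \<kappa> \<and> \<kappa> \<le> \<kappa>' \<longrightarrow> Delta_EKL Y f (downscale \<kappa> \<phi>) \<theta> p < 0)))"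
proof (intro ballI impI)
  fix \<theta> p
  assume \<theta>: "\<theta> \<in> \<Theta>" and p: "p \<in> P"
    and nz: "(LINT y|law Y p. upd_diff \<phi> y \<theta>) \<bullet> (LINT x|law Y p. score f x \<theta>) \<noteq> 0"
  from Hess_bound obtain c where c: "\<And>\<theta>'. \<theta>' \<in> \<Theta> \<Longrightarrow>
      integrable (law Y p) (\<lambda>x. Hess f x \<theta>') \<and> spectral_norm (LINT x|law Y p. Hess f x \<theta>') \<le> c"
    using p by blast
  have expansion: "\<bar>Delta_EKL Y f (downscale \<kappa> \<phi>) \<theta> p
      + \<kappa> * ((LINT y|law Y p. upd_diff \<phi> y \<theta>) \<bullet> (LINT x|law Y p. score f x \<theta>))\<bar>
    \<le> (c * (LINT y|law Y p. (norm (upd_diff \<phi> y \<theta>))\<^sup>2)) * \<kappa>\<^sup>2"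
    if "0 < \<kappa>" "\<kappa> \<le> 1" for \<kappa>
    by (rule Delta_EKL_downscale_expansion[OF P_density[OF p] \<theta> \<Theta>_convex f_density f_pos log_f_C2
          EKL_pred_fin[OF p] EKL_upd_fin[OF p \<theta> that] \<phi>_meas[OF \<theta>] \<phi>_in_\<Theta>[OF p \<theta>]
          score_fin[OF p \<theta>] upd_fin[OF p \<theta>] _ _ Hess_segment[OF p \<theta>] that])
       (use c in auto)
  show "(LINT y|law Y p. upd_diff \<phi> y \<theta>) \<bullet> (LINT x|law Y p. score f x \<theta>) > 0 \<longleftrightarrow>
       (\<exists>\<kappa>'>0. \<kappa>' \<le> 1 \<and>
          (\<forall>\<kappa>. 0 < \<kappa> \<and> \<kappa> \<le> \<kappa>' \<longrightarrow> Delta_EKL Y f (downscale \<kappa> \<phi>) \<theta> p < 0))"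
    by (rule eventually_negative_iff_slope[OF expansion nz])
qed

end
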